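(* Let $\lambda\in(0,\infty)$ and let $(X,Y)$ be a pair of positive random variables with $\Pr(X>x,Y>y)=\exp\{-V(1/x,1/y)\}$ for $x,y>0$, where $$V(x,y)=\frac1x\,\Phi\left\{\frac{\lambda}{2}+\frac1\lambda\log\left(\frac yx\right)\right\}+\frac1y\,\Phi\left\{\frac{\lambda}{2}+\frac1\lambda\log\left(\frac xy\right)\right\}.$$ Then for every $x>0$ and $z\in\mathbb{R}$, $$\lim_{u\to\infty}\Pr\left\{X-u>x,\ \frac{Y-a(X)}{b(X)}<z\ \Big|\ X>u\right\}=\exp(-x)\,G(z),$$ where, for all sufficiently large arguments $x$, $$a(x)=x\exp\left\{-\lambda(2\log x)^{1/2}+\frac{\lambda\log\log x}{(2\log x)^{1/2}}+\frac{\lambda^2}{2}\right\},\qquad b(x)=\frac{a(x)}{(\log x)^{1/2}},$$ and $$G(z)=1-\exp\left\{-\frac{\lambda}{(8\pi)^{1/2}}\exp\left(\sqrt2\,z/\lambda\right)\right\},\qquad z\in\mathbb{R}.$$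
   Context: $\Phi$ is the cumulative distribution function of the standard normal distribution. The law of $(X,Y)$ is the inverted max-stable distribution with unit exponential margins and H\"usler--Reiss (Smith) exponent measure $V$. *)

theory Defs
  imports "HOL-Probability.Probability"
begin

abbreviation std_normal_cdf :: "real \<Rightarrow> real" where
  "std_normal_cdf \<equiv> cdf std_normal_distribution"

definition husler_reiss_V :: "real \<Rightarrow> real \<Rightarrow> real \<Rightarrow> real" where
  "husler_reiss_V l x y =
     1 / x * std_normal_cdf (l / 2 + 1 / l * ln (y / x)) +
     1 / y * std_normal_cdf (l / 2 + 1 / l * ln (x / y))"

text \<open>The formulas for the norming functions are meaningful only for large arguments
  (where \<open>ln x > 0\<close>); elsewhere their values carry no information.\<close>

definition norming_a :: "real \<Rightarrow> real \<Rightarrow> real" where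
  "norming_a l x =
     x * exp (- l * sqrt (2 * ln x) + l * ln (ln x) / sqrt (2 * ln x) + l\<^sup>2 / 2)"

definition norming_b :: "real \<Rightarrow> real \<Rightarrow> real" where
  "norming_b l x = norming_a l x / sqrt (ln x)"

definition limit_G :: "real \<Rightarrow> real \<Rightarrow> real" where
  "limit_G l z = 1 - exp (- (l / sqrt (8 * pi)) * exp (sqrt 2 * z / l))"

end

theory Submission
  imports Defs "HOL-Real_Asymp.Real_Asymp"
begin

text \<open>
  Put \<open>\<tau> s = a s + b s * z\<close>. Since \<open>b\<close> is eventually positive, the event whose conditional
  probability is wanted is, for large \<open>u\<close> and with \<open>v = u + x\<close>, the event \<open>X > v\<close> with the part where
  \<open>Y \<ge> \<tau> X\<close> removed. The margin of \<open>X\<close> is unit exponential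
  (\<open>exponential_tail_from_joint_tail\<close>), so after division by \<open>\<P>(X > u) = exp (- u)\<close> everything reduces
  to showing that \<open>exp v * \<P>(X > v, Y \<ge> \<tau> X)\<close> tends to \<open>1 - G z\<close>.

  The boundary of this event is a curve, but it may be treated as a horizontal line. Given
  \<open>X > v\<close>, the excess \<open>X - v\<close> is of order one, whereas \<open>\<tau>\<close> is eventually increasing (\<open>norming_curve_strict_mono\<close>) and varies so slowly that,
  on the scale \<open>b\<close> that matters, \<open>\<tau> v\<close> and \<open>\<tau> (v + sqrt v)\<close> cannot be told apart. Hence the curved
  region \<open>Y \<ge> \<tau> X\<close> may be replaced by the quadrants \<open>Y > \<tau> v\<close> (too large) and
  \<open>Y > \<tau> (v + sqrt v)\<close> (too small up to the event \<open>X > v + sqrt v\<close>, whose probability is negligible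
  with respect to \<open>exp (- v)\<close>); this is \<open>joint_tail_sandwich\<close>. On quadrants the joint tail is given by
  \<open>V\<close>, and both bounds have the same limit as soon as \<open>V (1/s, 1/t) - s\<close> tends to
  \<open>l / sqrt (8 * pi) * exp (sqrt 2 * z / l)\<close> along \<open>t = \<tau> s\<close> and along \<open>t = \<tau> (s + sqrt s)\<close>.

  That limit (\<open>husler_reiss_V_excess_norming_curve\<close>) comes from normal tail asymptotics. With
  \<open>r = l / 2 + ln (s / t) / l\<close> and \<open>\<phi>\<close> the normal density, the identity
  \<open>t * \<phi> (r - l) = s * \<phi> r\<close> turns the excess \<open>V - s\<close> into \<open>s * \<phi> r\<close> times the increment
  of the Mills ratio from \<open>r\<close> to \<open>r - l\<close>, and this increment is asymptotic to \<open>l / r\<^sup>2\<close>. On the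
  curve one has \<open>r\<^sup>2 / 2 = ln s - ln (ln s) - sqrt 2 * z / l + o(1)\<close>: the leading term cancels the
  factor \<open>s\<close>, the double logarithm cancels \<open>r\<^sup>2\<close>, and \<open>z\<close> survives in the exponent. This explains
  the terms in the exponent of \<open>a\<close>; the constant \<open>l\<^sup>2 / 2\<close> there removes the summand \<open>l / 2\<close> of \<open>r\<close>.
\<close>

section \<open>The tail of the standard normal distribution\<close>

definition std_normal_tail :: "real \<Rightarrow> real" where
  "std_normal_tail x = 1 - std_normal_cdf x"

definition mills_ratio :: "real \<Rightarrow> real" where
  "mills_ratio x = std_normal_tail x / std_normal_density x"

lemma std_normal_tail_eq_measure_atLeast: "std_normal_tail x = measure std_normal_distribution {x..}"
proof -
  interpret N: real_distribution std_normal_distribution by (rule real_dist_normal_dist)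
  have "measure std_normal_distribution {x} = 0"
  proof -
    have "emeasure std_normal_distribution {x}
        = (\<integral>\<^sup>+y. ennreal (std_normal_density y) * indicator {x} y \<partial>lborel)"
      by (subst emeasure_density) auto
    also have "\<dots> = 0"
      by (subst nn_integral_0_iff_AE) (auto intro!: AE_I[where N="{x}"] simp: indicator_def)
    finally show ?thesis by (simp add: measure_def)
  qed
  moreover have "measure std_normal_distribution ({x} \<union> {x<..})
      = measure std_normal_distribution {x} + measure std_normal_distribution {x<..}"
    by (rule N.finite_measure_Union) auto
  moreover have "{x} \<union> {x<..} = {x..}" by auto
  moreover have "measure std_normal_distribution {x<..} = 1 - measure std_normal_distribution {..x}"
    using N.prob_compl[of "{..x}"] by (simp add: Compl_eq_Diff_UNIV[symmetric] del: Compl_eq_Diff_UNIV)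
  ultimately show ?thesis by (simp add: std_normal_tail_def cdf_def)
qed

lemma std_normal_cdf_minus: "std_normal_cdf (- x) = std_normal_tail x"
proof -
  have "emeasure std_normal_distribution {..-x}
      = (\<integral>\<^sup>+y. ennreal (std_normal_density y) * indicator {..-x} y \<partial>lborel)"
    by (subst emeasure_density) auto
  also have "\<dots> = (\<integral>\<^sup>+y. ennreal (std_normal_density (0 + -1 * y)) * indicator {..-x} (0 + -1 * y) \<partial>lborel)"
    by (subst nn_integral_real_affine[where c="-1" and t=0]) auto
  also have "\<dots> = (\<integral>\<^sup>+y. ennreal (std_normal_density y) * indicator {x..} y \<partial>lborel)"
    by (intro nn_integral_cong) (auto simp: normal_density_def indicator_def)
  also have "\<dots> = emeasure std_normal_distribution {x..}"
    by (subst emeasure_density) auto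
  finally show ?thesis
    by (simp add: cdf_def std_normal_tail_eq_measure_atLeast measure_def)
qed

lemma std_normal_tail_eq_nn_integral:
  "ennreal (std_normal_tail x) = (\<integral>\<^sup>+y\<in>{x..}. ennreal (std_normal_density y) \<partial>lborel)"
proof -
  interpret N: real_distribution std_normal_distribution by (rule real_dist_normal_dist)
  show ?thesis
    unfolding std_normal_tail_eq_measure_atLeast N.emeasure_eq_measure[symmetric]
    by (subst emeasure_density) auto
qed

lemma std_normal_density_has_derivative:
  "(std_normal_density has_real_derivative - x * std_normal_density x) (at x)"
  unfolding std_normal_density_def[abs_def]
  by (auto intro!: derivative_eq_intros simp: field_simps)

text \<open>
  The two bounds are consecutive truncations of the divergent expansion
  \<open>1/x - 1/x^3 + 3/x^5 - \<dots>\<close> of the Mills ratio. Each truncation times the density is, up to sign, a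
  primitive of the density times a factor that is below 1 in the first case and above 1 in
  the second, so integrating over \<open>{x..}\<close> compares it with the tail. Truncating after the first term
  would not suffice later: the difference of Mills ratios at \<open>x - l\<close> and \<open>x\<close> is of order \<open>1/x^2\<close>,
  so the bounds must agree to a better order than that.
\<close>

lemma mills_ratio_lower:
  assumes "x \<ge> 2"
  shows "1/x - 1/x^3 \<le> mills_ratio x"
proof -
  let ?F = "\<lambda>y. - (std_normal_density y * (1/y - 1/y^3))"
  let ?f = "\<lambda>y. std_normal_density y * (1 - 3/y^4)"
  have "(\<integral>\<^sup>+y\<in>{x..}. ennreal (?f y) \<partial>lborel) = ennreal (0 - ?F x)"
  proof (rule nn_integral_FTC_atLeast)
    show "(?F has_real_derivative ?f y) (at y)" if "x \<le> y" for y
      using assms that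
      by (auto intro!: derivative_eq_intros std_normal_density_has_derivative
          simp: field_simps eval_nat_numeral)
    show "0 \<le> ?f y" if "x \<le> y" for y
    proof -
      have "2^4 \<le> y^4" using assms that by (intro power_mono) auto
      hence "0 \<le> 1 - 3/y^4" by (simp add: divide_le_eq)
      thus ?thesis by (rule mult_nonneg_nonneg[rotated]) simp
    qed
    show "(?F \<longlongrightarrow> 0) at_top" unfolding std_normal_density_def by real_asymp
  qed measurable
  moreover have "(\<integral>\<^sup>+y\<in>{x..}. ennreal (?f y) \<partial>lborel) \<le> ennreal (std_normal_tail x)"
    unfolding std_normal_tail_eq_nn_integral
    by (intro nn_integral_mono mult_right_mono ennreal_leI)
       (auto simp: normal_density_def field_simps)
  ultimately have "ennreal (std_normal_density x * (1/x - 1/x^3)) \<le> ennreal (std_normal_tail x)"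
    by simp
  moreover have "0 \<le> std_normal_tail x"
    by (simp add: std_normal_tail_eq_measure_atLeast)
  ultimately have "std_normal_density x * (1/x - 1/x^3) \<le> std_normal_tail x"
    by (simp add: ennreal_le_iff)
  moreover have "std_normal_density x > 0" by (simp add: std_normal_density_def)
  ultimately show ?thesis by (simp add: mills_ratio_def pos_le_divide_eq mult.commute)
qed

lemma mills_ratio_upper:
  assumes "x \<ge> 2"
  shows "mills_ratio x \<le> 1/x - 1/x^3 + 3/x^5"
proof -
  let ?F = "\<lambda>y. - (std_normal_density y * (1/y - 1/y^3 + 3/y^5))"
  let ?f = "\<lambda>y. std_normal_density y * (1 + 15/y^6)"
  have "(\<integral>\<^sup>+y\<in>{x..}. ennreal (?f y) \<partial>lborel) = ennreal (0 - ?F x)"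
  proof (rule nn_integral_FTC_atLeast)
    show "(?F has_real_derivative ?f y) (at y)" if "x \<le> y" for y
      using assms that
      by (auto intro!: derivative_eq_intros std_normal_density_has_derivative
          simp: field_simps eval_nat_numeral)
    show "0 \<le> ?f y" if "x \<le> y" for y
      by (auto intro!: mult_nonneg_nonneg add_nonneg_nonneg)
    show "(?F \<longlongrightarrow> 0) at_top" unfolding std_normal_density_def by real_asymp
  qed measurable
  moreover have "ennreal (std_normal_tail x) \<le> (\<integral>\<^sup>+y\<in>{x..}. ennreal (?f y) \<partial>lborel)"
    unfolding std_normal_tail_eq_nn_integral
    by (intro nn_integral_mono mult_right_mono ennreal_leI)
       (auto simp: normal_density_def field_simps)
  ultimately have le: "ennreal (std_normal_tail x)
      \<le> ennreal (std_normal_density x * (1/x - 1/x^3 + 3/x^5))"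
    by simp
  have "1/x^3 \<le> 1/x" using assms by (simp add: divide_simps eval_nat_numeral mult_ge1_I)
  hence "0 \<le> std_normal_density x * (1/x - 1/x^3 + 3/x^5)"
    using assms by (intro mult_nonneg_nonneg) auto
  with le have "std_normal_tail x \<le> std_normal_density x * (1/x - 1/x^3 + 3/x^5)"
    by (simp add: ennreal_le_iff)
  moreover have "std_normal_density x > 0" by (simp add: std_normal_density_def)
  ultimately show ?thesis by (simp add: mills_ratio_def pos_divide_le_eq mult.commute)
qed

lemma mills_ratio_difference_asymptotics:
  "((\<lambda>x. x\<^sup>2 * (mills_ratio (x - l) - mills_ratio x)) \<longlongrightarrow> l) at_top"
proof (rule tendsto_sandwich)
  have ev: "\<forall>\<^sub>F x in at_top. x \<ge> 2 \<and> x - l \<ge> 2"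
    using eventually_ge_at_top[of "max 2 (2 + l)"] by eventually_elim auto
  show "\<forall>\<^sub>F x in at_top. x^2*((1/(x-l) - 1/(x-l)^3) - (1/x-1/x^3+3/x^5))
      \<le> x\<^sup>2 * (mills_ratio (x - l) - mills_ratio x)"
    using ev by eventually_elim
      (intro mult_left_mono diff_mono mills_ratio_lower mills_ratio_upper; simp)
  show "\<forall>\<^sub>F x in at_top. x\<^sup>2 * (mills_ratio (x - l) - mills_ratio x)
      \<le> x^2*((1/(x-l) - 1/(x-l)^3+3/(x-l)^5) - (1/x-1/x^3))"
    using ev by eventually_elim
      (intro mult_left_mono diff_mono mills_ratio_lower mills_ratio_upper; simp)
  show "((\<lambda>x. x^2*((1/(x-l) - 1/(x-l)^3) - (1/x-1/x^3+3/x^5))) \<longlongrightarrow> l) at_top"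
    by real_asymp
  show "((\<lambda>x. x^2*((1/(x-l) - 1/(x-l)^3+3/(x-l)^5) - (1/x-1/x^3))) \<longlongrightarrow> l) at_top"
    by real_asymp
qed

section \<open>The exponent measure off the diagonal\<close>

text \<open>
  At \<open>(1/s, 1/t)\<close> the arguments of the two normal distribution functions in \<open>V\<close> are
  \<open>r\<close> and \<open>l - r\<close>, where \<open>r\<close> is the following quantity.
\<close>

definition husler_reiss_arg :: "real \<Rightarrow> real \<Rightarrow> real \<Rightarrow> real" where
  "husler_reiss_arg l s t = l / 2 + ln (s / t) / l"

text \<open>
  By symmetry of the normal distribution \<open>V\<close> exceeds \<open>s\<close> by \<open>t\<close> times the tail at \<open>r - l\<close> minus \<open>s\<close>
  times the tail at \<open>r\<close>. The two terms have the same leading order, and the factors in front of the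
  Mills ratios are even equal, so the excess is governed by a difference of Mills ratios.
\<close>

lemma husler_reiss_V_excess:
  assumes "l > 0" "s > 0" "t > 0"
  defines "r \<equiv> husler_reiss_arg l s t"
  shows "husler_reiss_V l (1/s) (1/t) - s
    = s * std_normal_density r * (mills_ratio (r - l) - mills_ratio r)"
proof -
  have lnts: "ln (t / s) = - ln (s / t)" using assms by (simp add: ln_div)
  have "l / 2 + 1 / l * ln (t / s) = - (r - l)"
    unfolding lnts by (simp add: r_def husler_reiss_arg_def)
  hence V: "husler_reiss_V l (1/s) (1/t) = s * std_normal_cdf r + t * std_normal_cdf (- (r - l))"
    by (simp add: husler_reiss_V_def r_def husler_reiss_arg_def)
  have "t = s * exp (- ln (s / t))" using assms by (simp add: exp_minus field_simps)
  also have "ln (s / t) = r * l - l\<^sup>2 / 2"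
    using assms(1) by (simp add: r_def husler_reiss_arg_def field_simps power2_eq_square)
  finally have "t * std_normal_density (r - l)
      = s * (exp (- (r * l - l\<^sup>2/2)) * std_normal_density (r - l))" by simp
  also have "exp (- (r * l - l\<^sup>2/2)) * std_normal_density (r - l) = std_normal_density r"
    by (simp add: std_normal_density_def exp_add[symmetric] field_simps power2_eq_square)
  finally have dens: "t * std_normal_density (r - l) = s * std_normal_density r" .
  have pos: "std_normal_density y > 0" for y by (simp add: std_normal_density_def)
  have tail: "std_normal_tail y = std_normal_density y * mills_ratio y" for y
    using pos[of y] by (simp add: mills_ratio_def)
  have "husler_reiss_V l (1/s) (1/t) - s = t * std_normal_tail (r - l) - s * std_normal_tail r"
    unfolding V std_normal_cdf_minus by (simp add: std_normal_tail_def algebra_simps)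
  also have "\<dots> = s * std_normal_density r * (mills_ratio (r - l) - mills_ratio r)"
    unfolding tail mult.assoc[symmetric] dens by (simp add: algebra_simps)
  finally show ?thesis .
qed

lemma husler_reiss_V_excess_tendsto:
  assumes "l > 0"
    and pos: "\<forall>\<^sub>F s in at_top. t s > 0"
    and r: "filterlim (\<lambda>s. husler_reiss_arg l s (t s)) at_top at_top"
    and lim: "((\<lambda>s. s * std_normal_density (husler_reiss_arg l s (t s)) / (husler_reiss_arg l s (t s))\<^sup>2) \<longlongrightarrow> c) at_top"
  shows "((\<lambda>s. husler_reiss_V l (1/s) (1 / t s) - s) \<longlongrightarrow> c * l) at_top"
proof -
  let ?r = "\<lambda>s. husler_reiss_arg l s (t s)"
  have "((\<lambda>s. (?r s)\<^sup>2 * (mills_ratio (?r s - l) - mills_ratio (?r s))) \<longlongrightarrow> l) at_top"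
    by (rule filterlim_compose[OF mills_ratio_difference_asymptotics r])
  from tendsto_mult[OF lim this] show ?thesis
  proof (rule Lim_transform_eventually)
    have "\<forall>\<^sub>F s in at_top. ?r s > 0"
      using r by (rule filterlim_at_top_dense[THEN iffD1, rule_format])
    thus "\<forall>\<^sub>F s in at_top. s * std_normal_density (?r s) / (?r s)\<^sup>2 *
        ((?r s)\<^sup>2 * (mills_ratio (?r s - l) - mills_ratio (?r s)))
        = husler_reiss_V l (1/s) (1 / t s) - s"
      using pos eventually_gt_at_top[of 0]
      by eventually_elim (use assms(1) in \<open>simp add: husler_reiss_V_excess\<close>)
  qed
qed

section \<open>The norming curve\<close>

definition norming_curve :: "real \<Rightarrow> real \<Rightarrow> real \<Rightarrow> real" where
  "norming_curve l z s = norming_a l s + norming_b l s * z"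

lemma norming_curve_eq:
  assumes "s > 0"
  shows "norming_curve l z s = norming_a l s * (1 + z / sqrt (ln s))"
  by (simp add: norming_curve_def norming_b_def algebra_simps)

lemma eventually_norming_curve_factor_pos:
  "\<forall>\<^sub>F s in at_top. 1 + z / sqrt (ln s) > (0::real)"
  by real_asymp

lemma norming_curve_pos:
  assumes "s > 0" "1 + z / sqrt (ln s) > 0"
  shows "norming_curve l z s > 0"
  using assms by (simp add: norming_curve_eq norming_a_def)

lemma ln_norming_curve:
  assumes "s > 1" "1 + z / sqrt (ln s) > 0"
  shows "ln (norming_curve l z s)
    = ln s - l * sqrt (2 * ln s) + l * ln (ln s) / sqrt (2 * ln s) + l\<^sup>2 / 2 + ln (1 + z / sqrt (ln s))"
  using assms by (simp add: norming_curve_eq norming_a_def ln_mult)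

text \<open>
  In the variable \<open>w = sqrt (ln s)\<close> the logarithm of the curve is \<open>w\<^sup>2\<close> plus terms of lower order,
  with derivative \<open>2 * w + O(1)\<close>.
\<close>

lemma norming_curve_strict_mono:
  "\<exists>s0. strict_mono_on {s0..} (norming_curve l z)"
proof -
  define k where "k = l * sqrt 2"
  define h where "h = (\<lambda>w. w\<^sup>2 - k * w + k * ln w / w + l\<^sup>2 / 2 + ln (1 + z / w))"
  define h' where "h' = (\<lambda>w. 2 * w - k + k * (1 - ln w) / w\<^sup>2 - z / (w * (w + z)))"
  have "\<forall>\<^sub>F w in at_top. h' w > 0" unfolding h'_def by real_asymp
  moreover have "\<forall>\<^sub>F w in at_top. 1 + z / w > 0" by real_asymp
  ultimately have "\<forall>\<^sub>F w in at_top. h' w > 0 \<and> w > 0 \<and> 1 + z / w > 0"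
    using eventually_gt_at_top[of 0] by eventually_elim auto
  then obtain w0 where w0: "\<And>w. w \<ge> w0 \<Longrightarrow> h' w > 0 \<and> w > 0 \<and> 1 + z / w > 0"
    by (auto simp: eventually_at_top_linorder)
  have deriv: "(h has_real_derivative h' w) (at w)" if "w \<ge> w0" for w
  proof -
    have w: "w > 0" "1 + z / w > 0" "w + z > 0"
      using w0[OF that] by (auto simp: field_simps)
    have "((\<lambda>w. ln (1 + z / w)) has_real_derivative (- z / w\<^sup>2) / (1 + z / w)) (at w)"
      using w by (auto intro!: derivative_eq_intros simp: power2_eq_square)
    also have "(- z / w\<^sup>2) / (1 + z / w) = - z / (w * (w + z))"
      using w by (simp add: field_simps power2_eq_square)
    finally have ln_deriv:
      "((\<lambda>w. ln (1 + z / w)) has_real_derivative - z / (w * (w + z))) (at w)" .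
    have quad_deriv: "((\<lambda>w. w\<^sup>2 - k * w) has_real_derivative 2 * w - k) (at w)"
      by (auto intro!: derivative_eq_intros)
    have quot_deriv: "((\<lambda>w. k * ln w / w) has_real_derivative k * (1 - ln w) / w\<^sup>2) (at w)"
      using w by (auto intro!: derivative_eq_intros simp: field_simps power2_eq_square)
    show ?thesis unfolding h_def h'_def
      by (rule DERIV_cong[OF DERIV_add[OF DERIV_add[OF DERIV_add[OF quad_deriv quot_deriv]
            DERIV_const] ln_deriv]]) simp
  qed
  have "\<forall>\<^sub>F s in at_top. sqrt (ln s) \<ge> w0" by real_asymp
  hence "\<forall>\<^sub>F s in at_top. sqrt (ln s) \<ge> w0 \<and> s > 1"
    using eventually_gt_at_top[of 1] by eventually_elim auto
  then obtain s0 where s0: "\<And>s. s \<ge> s0 \<Longrightarrow> sqrt (ln s) \<ge> w0 \<and> s > 1"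
    by (auto simp: eventually_at_top_linorder)
  have curve: "norming_curve l z s > 0" "ln (norming_curve l z s) = h (sqrt (ln s))"
    if "s \<ge> s0" for s
  proof -
    have s: "s > 1" "1 + z / sqrt (ln s) > 0" using s0[OF that] w0 by auto
    show "norming_curve l z s > 0" using s by (intro norming_curve_pos) auto
    have "l * sqrt (2 * ln s) = k * sqrt (ln s)" by (simp add: k_def real_sqrt_mult)
    moreover have "l * ln (ln s) / sqrt (2 * ln s) = k * ln (sqrt (ln s)) / sqrt (ln s)"
      using s by (simp add: k_def real_sqrt_mult ln_sqrt field_simps)
    ultimately show "ln (norming_curve l z s) = h (sqrt (ln s))"
      using s by (simp add: ln_norming_curve h_def)
  qed
  have "strict_mono_on {s0..} (norming_curve l z)"
  proof (rule strict_mono_onI)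
    fix p q assume pq: "p \<in> {s0..}" "q \<in> {s0..}" "p < q"
    have "sqrt (ln p) < sqrt (ln q)" using s0[of p] s0[of q] pq by simp
    hence "h (sqrt (ln p)) < h (sqrt (ln q))"
    proof (rule DERIV_pos_imp_increasing)
      fix w assume "sqrt (ln p) \<le> w" "w \<le> sqrt (ln q)"
      hence "w \<ge> w0" using s0[of p] pq by simp
      thus "\<exists>y. (h has_real_derivative y) (at w) \<and> 0 < y" using deriv w0 by blast
    qed
    thus "norming_curve l z p < norming_curve l z q"
      using pq curve[of p] curve[of q] by (metis atLeast_iff ln_less_cancel_iff)
  qed
  thus ?thesis ..
qed

text \<open>
  Here \<open>R s = sqrt (2 * ln s) - d s\<close> with \<open>d s\<close> tending to 0. In the square only the cross
  term \<open>sqrt (2 * ln s) * d s\<close> survives besides \<open>2 * ln s\<close>; it equals \<open>ln (ln s)\<close> plus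
  \<open>sqrt 2 / l * sqrt (ln s) * ln (1 + z / sqrt (ln s))\<close>, whose limit is \<open>sqrt 2 * z / l\<close>.
\<close>

lemma husler_reiss_arg_norming_curve_asymptotics:
  fixes l z :: real
  assumes "l > 0"
  defines "R \<equiv> \<lambda>s. husler_reiss_arg l s (norming_curve l z s)"
  shows "((\<lambda>s. R s / sqrt (ln s)) \<longlongrightarrow> sqrt 2) at_top"
    and "((\<lambda>s. ln s - (R s)\<^sup>2 / 2 - ln (ln s)) \<longlongrightarrow> sqrt 2 * z / l) at_top"
proof -
  define m where "m = (\<lambda>s. ln (1 + z / sqrt (ln s)))"
  define d where "d = (\<lambda>s. ln (ln s) / sqrt (2 * ln s) + m s / l)"
  have R: "\<forall>\<^sub>F s in at_top. s > 1 \<and> R s = sqrt (2 * ln s) - d s"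
    using eventually_gt_at_top[of 1] eventually_norming_curve_factor_pos[of z]
  proof eventually_elim
    case (elim s)
    have "norming_curve l z s > 0" using elim by (intro norming_curve_pos) auto
    thus ?case using elim assms(1)
      by (simp add: R_def husler_reiss_arg_def ln_div ln_norming_curve d_def m_def field_simps power2_eq_square)
  qed
  have d: "((\<lambda>s. d s) \<longlongrightarrow> 0) at_top" and "((\<lambda>s. d s / sqrt (ln s)) \<longlongrightarrow> 0) at_top"
    unfolding d_def m_def using assms(1) by real_asymp+
  hence "((\<lambda>s. sqrt 2 - d s / sqrt (ln s)) \<longlongrightarrow> sqrt 2 - 0) at_top"
    by (intro tendsto_intros)
  hence "((\<lambda>s. sqrt 2 - d s / sqrt (ln s)) \<longlongrightarrow> sqrt 2) at_top" by simp
  thus "((\<lambda>s. R s / sqrt (ln s)) \<longlongrightarrow> sqrt 2) at_top"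
    by (rule Lim_transform_eventually)
       (use R in \<open>eventually_elim, auto simp: real_sqrt_mult field_simps\<close>)
  have "((\<lambda>s. sqrt (ln s) * m s) \<longlongrightarrow> z) at_top" unfolding m_def by real_asymp
  hence "((\<lambda>s. sqrt 2 * (sqrt (ln s) * m s) / l - (d s)\<^sup>2 / 2) \<longlongrightarrow> sqrt 2 * z / l - 0\<^sup>2 / 2) at_top"
    using d assms(1) by (intro tendsto_intros) auto
  hence "((\<lambda>s. sqrt 2 * (sqrt (ln s) * m s) / l - (d s)\<^sup>2 / 2) \<longlongrightarrow> sqrt 2 * z / l) at_top"
    by simp
  thus "((\<lambda>s. ln s - (R s)\<^sup>2 / 2 - ln (ln s)) \<longlongrightarrow> sqrt 2 * z / l) at_top"
  proof (rule Lim_transform_eventually)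
    show "\<forall>\<^sub>F s in at_top. sqrt 2 * (sqrt (ln s) * m s) / l - (d s)\<^sup>2 / 2
        = ln s - (R s)\<^sup>2 / 2 - ln (ln s)"
      using R
    proof eventually_elim
      case (elim s)
      hence pos: "ln s > 0" by simp
      have "(R s)\<^sup>2 = 2 * ln s - 2 * (sqrt (2 * ln s) * d s) + (d s)\<^sup>2"
        using elim pos by (simp add: power2_diff)
      moreover have "sqrt (2 * ln s) * d s = ln (ln s) + sqrt 2 * (sqrt (ln s) * m s) / l"
        using pos by (simp add: d_def ring_distribs real_sqrt_mult)
      ultimately show ?case by linarith
    qed
  qed
qed

text \<open>
  The reparametrisation \<open>\<sigma>\<close> covers the upper and the lower bound of the sandwich at once, namely
  \<open>\<sigma> s = s\<close> and \<open>\<sigma> s = s + sqrt s\<close>. Replacing \<open>s\<close> by \<open>\<sigma> s\<close> on the curve shifts \<open>r\<close> by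
  \<open>D / l\<close> with \<open>D = ln (\<sigma> s) - ln s\<close>. As \<open>r\<close> grows like \<open>sqrt (2 * ln s)\<close>, the effect on
  \<open>r\<^sup>2\<close> vanishes precisely when \<open>D * sqrt (ln (\<sigma> s))\<close> tends to 0.
\<close>

lemma husler_reiss_V_excess_norming_curve:
  fixes l z :: real and \<sigma> :: "real \<Rightarrow> real"
  assumes "l > 0"
    and \<sigma>: "filterlim \<sigma> at_top at_top"
    and close: "((\<lambda>s. (ln (\<sigma> s) - ln s) * sqrt (ln (\<sigma> s))) \<longlongrightarrow> 0) at_top"
  shows "((\<lambda>s. husler_reiss_V l (1/s) (1 / norming_curve l z (\<sigma> s)) - s)
    \<longlongrightarrow> l / sqrt (8 * pi) * exp (sqrt 2 * z / l)) at_top"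
proof -
  define D where "D = (\<lambda>s. ln (\<sigma> s) - ln s)"
  define q where "q = (\<lambda>s. sqrt (ln (\<sigma> s)))"
  define R where "R = (\<lambda>s. husler_reiss_arg l (\<sigma> s) (norming_curve l z (\<sigma> s)))"
  define r where "r = (\<lambda>s. husler_reiss_arg l s (norming_curve l z (\<sigma> s)))"
  have Dq: "((\<lambda>s. D s * q s) \<longlongrightarrow> 0) at_top" using close by (simp add: D_def q_def)
  have "filterlim (\<lambda>s::real. sqrt (ln s)) at_top at_top" by real_asymp
  hence q: "filterlim q at_top at_top"
    unfolding q_def by (rule filterlim_compose[OF _ \<sigma>])
  have q_pos: "\<forall>\<^sub>F s in at_top. q s > 0"
    using q by (rule filterlim_at_top_dense[THEN iffD1, rule_format])
  have curve_pos: "\<forall>\<^sub>F s in at_top. norming_curve l z (\<sigma> s) > 0"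
  proof -
    have "\<forall>\<^sub>F s in at_top. norming_curve l z s > 0"
      using eventually_gt_at_top[of 0] eventually_norming_curve_factor_pos[of z]
      by eventually_elim (rule norming_curve_pos)
    thus ?thesis by (rule eventually_compose_filterlim[OF _ \<sigma>])
  qed
  have \<sigma>_gt: "\<forall>\<^sub>F s in at_top. \<sigma> s > 1"
    using \<sigma> by (rule filterlim_at_top_dense[THEN iffD1, rule_format])
  have Rq: "((\<lambda>s. R s / q s) \<longlongrightarrow> sqrt 2) at_top"
    unfolding R_def q_def
    by (rule filterlim_compose[OF husler_reiss_arg_norming_curve_asymptotics(1)[OF assms(1)] \<sigma>])
  have E: "((\<lambda>s. ln (\<sigma> s) - (R s)\<^sup>2 / 2 - ln (ln (\<sigma> s))) \<longlongrightarrow> sqrt 2 * z / l) at_top"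
    unfolding R_def
    by (rule filterlim_compose[OF husler_reiss_arg_norming_curve_asymptotics(2)[OF assms(1)] \<sigma>])
  have inv_q: "((\<lambda>s. 1 / q s) \<longlongrightarrow> 0) at_top"
    using q by (intro tendsto_divide_0[OF tendsto_const] filterlim_at_top_imp_at_infinity)
  have "((\<lambda>s. D s * q s * (1 / q s)) \<longlongrightarrow> 0 * 0) at_top"
    by (intro tendsto_mult Dq inv_q)
  hence D: "(D \<longlongrightarrow> 0) at_top"
    by (simp add: Lim_transform_eventually[OF _ eventually_mono[OF q_pos]])
  have r: "\<forall>\<^sub>F s in at_top. r s = R s - D s / l"
    using curve_pos \<sigma>_gt eventually_gt_at_top[of 0]
    by eventually_elim
      (use assms(1) in \<open>simp add: r_def R_def husler_reiss_arg_def D_def ln_div field_simps\<close>)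
  have "((\<lambda>s. R s / q s - D s * (1 / q s) / l) \<longlongrightarrow> sqrt 2 - 0 * 0 / l) at_top"
    using assms(1) by (intro tendsto_intros Rq D inv_q) auto
  hence "((\<lambda>s. R s / q s - D s * (1 / q s) / l) \<longlongrightarrow> sqrt 2) at_top" by simp
  hence rq: "((\<lambda>s. r s / q s) \<longlongrightarrow> sqrt 2) at_top"
    by (rule Lim_transform_eventually)
       (use r in \<open>eventually_elim, simp add: diff_divide_distrib\<close>)
  have r_top: "filterlim r at_top at_top"
  proof -
    have "filterlim (\<lambda>s. (r s / q s) * q s) at_top at_top"
      by (rule filterlim_tendsto_pos_mult_at_top[OF rq _ q]) simp
    moreover have "\<forall>\<^sub>F s in at_top. (r s / q s) * q s = r s"
      using q_pos by eventually_elim simp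
    ultimately show ?thesis by (simp cong: filterlim_cong)
  qed
  have Exp: "((\<lambda>s. ln s - (r s)\<^sup>2 / 2 - ln (ln (\<sigma> s))) \<longlongrightarrow> sqrt 2 * z / l) at_top"
  proof -
    have "((\<lambda>s. (ln (\<sigma> s) - (R s)\<^sup>2 / 2 - ln (ln (\<sigma> s))) - D s
        + (R s / q s) * (D s * q s) / l - (D s / l)\<^sup>2 / 2)
      \<longlongrightarrow> sqrt 2 * z / l - 0 + sqrt 2 * 0 / l - (0 / l)\<^sup>2 / 2) at_top"
      using assms(1) by (intro tendsto_intros E D Rq Dq) auto
    hence "((\<lambda>s. (ln (\<sigma> s) - (R s)\<^sup>2 / 2 - ln (ln (\<sigma> s))) - D s
        + (R s / q s) * (D s * q s) / l - (D s / l)\<^sup>2 / 2)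
      \<longlongrightarrow> sqrt 2 * z / l) at_top" by simp
    thus ?thesis
    proof (rule Lim_transform_eventually)
      show "\<forall>\<^sub>F s in at_top. (ln (\<sigma> s) - (R s)\<^sup>2 / 2 - ln (ln (\<sigma> s))) - D s
          + (R s / q s) * (D s * q s) / l - (D s / l)\<^sup>2 / 2
          = ln s - (r s)\<^sup>2 / 2 - ln (ln (\<sigma> s))"
        using r q_pos
      proof eventually_elim
        case (elim s)
        have "(r s)\<^sup>2 = (R s)\<^sup>2 - 2 * (R s * (D s / l)) + (D s / l)\<^sup>2"
          using elim by (simp add: power2_diff)
        moreover have "(R s / q s) * (D s * q s) / l = R s * (D s / l)" using elim by simp
        moreover have "ln s = ln (\<sigma> s) - D s" by (simp add: D_def)
        ultimately show ?case by argo
      qed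
    qed
  qed
  (* The factor s goes into the exponent; the term ln (ln (\<sigma> s)) there is
     compensated by dividing r by q, that is by inserting the factor q^2 = ln (\<sigma> s). *)
  have "((\<lambda>s. 1 / sqrt (2 * pi) * exp (ln s - (r s)\<^sup>2 / 2 - ln (ln (\<sigma> s))) / (r s / q s)\<^sup>2)
      \<longlongrightarrow> 1 / sqrt (2 * pi) * exp (sqrt 2 * z / l) / (sqrt 2)\<^sup>2) at_top"
    by (intro tendsto_intros Exp rq) auto
  hence "((\<lambda>s. s * std_normal_density (r s) / (r s)\<^sup>2)
      \<longlongrightarrow> 1 / sqrt (2 * pi) * exp (sqrt 2 * z / l) / (sqrt 2)\<^sup>2) at_top"
  proof (rule Lim_transform_eventually)
    show "\<forall>\<^sub>F s in at_top. 1 / sqrt (2 * pi) * exp (ln s - (r s)\<^sup>2 / 2 - ln (ln (\<sigma> s))) / (r s / q s)\<^sup>2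
        = s * std_normal_density (r s) / (r s)\<^sup>2"
      using \<sigma>_gt eventually_gt_at_top[of 0]
    proof eventually_elim
      case (elim s)
      have "exp (ln s - (r s)\<^sup>2 / 2 - ln (ln (\<sigma> s)))
          = exp (ln s) * exp (- (r s)\<^sup>2 / 2) / exp (ln (ln (\<sigma> s)))"
        by (simp flip: exp_add exp_diff)
      hence "exp (ln s - (r s)\<^sup>2 / 2 - ln (ln (\<sigma> s))) = s * exp (- (r s)\<^sup>2 / 2) / ln (\<sigma> s)"
        using elim by simp
      moreover have "(q s)\<^sup>2 = ln (\<sigma> s)" "ln (\<sigma> s) > 0" using elim by (simp_all add: q_def)
      ultimately show ?case
        by (simp add: std_normal_density_def power_divide)
    qed
  qed
  from husler_reiss_V_excess_tendsto[OF assms(1) curve_pos r_top[unfolded r_def] this[unfolded r_def]]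
  have "((\<lambda>s. husler_reiss_V l (1/s) (1 / norming_curve l z (\<sigma> s)) - s)
      \<longlongrightarrow> 1 / sqrt (2 * pi) * exp (sqrt 2 * z / l) / (sqrt 2)\<^sup>2 * l) at_top" .
  moreover have "sqrt (8 * pi) = 2 * sqrt (2 * pi)"
    using real_sqrt_mult[of 4 "2 * pi"] by simp
  ultimately show ?thesis by (simp add: field_simps)
qed

section \<open>Conditioning on a large first coordinate\<close>

text \<open>
  If \<open>v < X\<close>, then \<open>\<tau> v < \<tau> X\<close>; if moreover \<open>X \<le> w\<close>, then \<open>\<tau> X \<le> \<tau> w\<close>. So a curved region lies
  between two quadrants, up to the event \<open>X > w\<close>. Strict monotonicity absorbs the difference between
  \<open>\<ge>\<close> and \<open>>\<close>.
\<close>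

lemma (in prob_space) joint_tail_sandwich:
  fixes X Y :: "'a \<Rightarrow> real"
  assumes [measurable]: "X \<in> borel_measurable M" "Y \<in> borel_measurable M" "\<tau> \<in> borel_measurable borel"
    and mono: "strict_mono_on {s0..} \<tau>" and "s0 \<le> v" "v \<le> w"
  shows "\<P>(\<omega> in M. X \<omega> > v \<and> Y \<omega> > \<tau> w) - \<P>(\<omega> in M. X \<omega> > w)
      \<le> \<P>(\<omega> in M. X \<omega> > v \<and> Y \<omega> \<ge> \<tau> (X \<omega>))"
    and "\<P>(\<omega> in M. X \<omega> > v \<and> Y \<omega> \<ge> \<tau> (X \<omega>)) \<le> \<P>(\<omega> in M. X \<omega> > v \<and> Y \<omega> > \<tau> v)"
proof -
  have "Y \<omega> \<ge> \<tau> (X \<omega>)" if "X \<omega> > v" "Y \<omega> > \<tau> w" "\<not> X \<omega> > w" for \<omega>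
    using that mono assms(5,6) strict_mono_onD[OF mono, of "X \<omega>" w] by (cases "X \<omega> = w") auto
  hence "{\<omega>\<in>space M. X \<omega> > v \<and> Y \<omega> > \<tau> w}
      \<subseteq> {\<omega>\<in>space M. X \<omega> > v \<and> Y \<omega> \<ge> \<tau> (X \<omega>)} \<union> {\<omega>\<in>space M. X \<omega> > w}"
    by blast
  hence "\<P>(\<omega> in M. X \<omega> > v \<and> Y \<omega> > \<tau> w)
      \<le> prob ({\<omega>\<in>space M. X \<omega> > v \<and> Y \<omega> \<ge> \<tau> (X \<omega>)} \<union> {\<omega>\<in>space M. X \<omega> > w})"
    by (rule finite_measure_mono) measurable
  also have "\<dots> \<le> \<P>(\<omega> in M. X \<omega> > v \<and> Y \<omega> \<ge> \<tau> (X \<omega>)) + \<P>(\<omega> in M. X \<omega> > w)"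
    by (rule measure_Un_le) measurable
  finally show "\<P>(\<omega> in M. X \<omega> > v \<and> Y \<omega> > \<tau> w) - \<P>(\<omega> in M. X \<omega> > w)
      \<le> \<P>(\<omega> in M. X \<omega> > v \<and> Y \<omega> \<ge> \<tau> (X \<omega>))" by simp
  have "\<tau> v < Y \<omega>" if "X \<omega> > v" "Y \<omega> \<ge> \<tau> (X \<omega>)" for \<omega>
    using that assms(5) strict_mono_onD[OF mono, of v "X \<omega>"] by auto
  thus "\<P>(\<omega> in M. X \<omega> > v \<and> Y \<omega> \<ge> \<tau> (X \<omega>)) \<le> \<P>(\<omega> in M. X \<omega> > v \<and> Y \<omega> > \<tau> v)"
    by (intro finite_measure_mono) auto
qed

lemma std_normal_cdf_tendsto_1: "(std_normal_cdf \<longlongrightarrow> 1) at_top"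
  by (rule real_distribution.cdf_lim_at_top_prob[OF real_dist_normal_dist])

text \<open>
  Let \<open>t = 1 / Suc n\<close> decrease to 0 in the joint tail: as \<open>Y > 0\<close> almost surely, the left-hand side
  tends to the marginal tail, while both normal arguments in \<open>V\<close> go to infinity in absolute value
  and leave \<open>V = s\<close>.
\<close>

lemma (in prob_space) exponential_tail_from_joint_tail:
  fixes X Y :: "'a \<Rightarrow> real"
  assumes [measurable]: "X \<in> borel_measurable M" "Y \<in> borel_measurable M"
    and Y_pos: "AE \<omega> in M. Y \<omega> > 0" and "l > 0"
    and joint: "\<And>s t. s > 0 \<Longrightarrow> t > 0 \<Longrightarrow>
           \<P>(\<omega> in M. X \<omega> > s \<and> Y \<omega> > t) = exp (- husler_reiss_V l (1 / s) (1 / t))"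
    and "s > 0"
  shows "\<P>(\<omega> in M. X \<omega> > s) = exp (- s)"
proof -
  let ?A = "\<lambda>n. {\<omega>\<in>space M. X \<omega> > s \<and> Y \<omega> > 1 / real (Suc n)}"
  have "(\<lambda>n. prob (?A n)) \<longlonglongrightarrow> prob (\<Union>n. ?A n)"
  proof (rule finite_Lim_measure_incseq)
    show "incseq ?A"
    proof (rule monoI)
      fix m n :: nat assume "m \<le> n"
      hence "1 / real (Suc n) \<le> 1 / real (Suc m)" by (simp add: frac_le)
      thus "?A m \<subseteq> ?A n" by (auto intro: le_less_trans)
    qed
  qed auto
  also have "(\<Union>n. ?A n) = {\<omega>\<in>space M. X \<omega> > s \<and> Y \<omega> > 0}"
  proof (intro equalityI subsetI)
    fix \<omega> assume "\<omega> \<in> {\<omega>\<in>space M. X \<omega> > s \<and> Y \<omega> > 0}"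
    moreover from this obtain n where "1 / real (Suc n) < Y \<omega>"
      using nat_approx_posE[of "Y \<omega>"] by blast
    ultimately show "\<omega> \<in> (\<Union>n. ?A n)" by blast
  next
    fix \<omega> assume "\<omega> \<in> (\<Union>n. ?A n)"
    thus "\<omega> \<in> {\<omega>\<in>space M. X \<omega> > s \<and> Y \<omega> > 0}" by (auto intro: less_trans[rotated])
  qed
  also have "prob \<dots> = \<P>(\<omega> in M. X \<omega> > s)"
    by (rule measure_eq_AE) (use Y_pos in auto)
  finally have 1: "(\<lambda>n. prob (?A n)) \<longlonglongrightarrow> \<P>(\<omega> in M. X \<omega> > s)" .
  have eq: "prob (?A n) = exp (- (s * std_normal_cdf (l/2 + 1/l * ln (real (Suc n) * s))
      + 1 / real (Suc n) * std_normal_tail (1/l * ln (real (Suc n) * s) - l/2)))" for n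
  proof -
    have "ln (1 / (real (Suc n) * s)) = - ln (real (Suc n) * s)"
      using \<open>s > 0\<close> by (simp add: ln_div)
    hence "l/2 + 1/l * ln (1 / (real (Suc n) * s)) = - (1/l * ln (real (Suc n) * s) - l/2)"
      by simp
    thus ?thesis
      using joint[of s "1 / real (Suc n)"] \<open>s > 0\<close>
      by (simp add: husler_reiss_V_def std_normal_cdf_minus[symmetric] mult.commute del: of_nat_Suc)
  qed
  have cdf_top: "((\<lambda>n. std_normal_cdf (f n)) \<longlonglongrightarrow> 1)" if "filterlim f at_top sequentially" for f
    using filterlim_compose[OF std_normal_cdf_tendsto_1 that] .
  have "(\<lambda>n. exp (- (s * std_normal_cdf (l/2 + 1/l * ln (real (Suc n) * s))
      + 1 / real (Suc n) * std_normal_tail (1/l * ln (real (Suc n) * s) - l/2))))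
    \<longlonglongrightarrow> exp (- (s * 1 + 0 * (1 - 1)))"
    unfolding std_normal_tail_def
  proof (intro tendsto_intros cdf_top)
    show "LIM n sequentially. l/2 + 1/l * ln (real (Suc n) * s) :> at_top"
      "LIM n sequentially. 1/l * ln (real (Suc n) * s) - l/2 :> at_top"
      "(\<lambda>n. 1 / real (Suc n)) \<longlonglongrightarrow> 0"
      using \<open>s > 0\<close> \<open>l > 0\<close> by real_asymp+
  qed
  hence "(\<lambda>n. prob (?A n)) \<longlonglongrightarrow> exp (- s)" unfolding eq by simp
  with 1 show ?thesis by (rule LIMSEQ_unique)
qed

lemma borel_measurable_norming_curve [measurable]: "norming_curve l z \<in> borel_measurable borel"
  unfolding norming_curve_def[abs_def] norming_b_def norming_a_def by measurable

text \<open>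
  The upper end \<open>w = v + sqrt v\<close> in the sandwich is a compromise: \<open>w - v\<close> must go to infinity, so
  that \<open>X > w\<close> is negligible given \<open>X > v\<close>, but slowly enough that
  \<open>(ln w - ln v) * sqrt (ln w)\<close>, which is about \<open>sqrt (ln v / v)\<close>, still vanishes.
\<close>

lemma (in prob_space) scaled_tail_above_norming_curve:
  fixes X Y :: "'a \<Rightarrow> real"
  assumes [measurable]: "X \<in> borel_measurable M" "Y \<in> borel_measurable M"
    and "l > 0"
    and X_tail: "\<And>s. s > 0 \<Longrightarrow> \<P>(\<omega> in M. X \<omega> > s) = exp (- s)"
    and joint: "\<And>s t. s > 0 \<Longrightarrow> t > 0 \<Longrightarrow>
           \<P>(\<omega> in M. X \<omega> > s \<and> Y \<omega> > t) = exp (- husler_reiss_V l (1 / s) (1 / t))"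
  shows "((\<lambda>v. exp v * \<P>(\<omega> in M. X \<omega> > v \<and> Y \<omega> \<ge> norming_curve l z (X \<omega>)))
    \<longlongrightarrow> 1 - limit_G l z) at_top"
proof -
  define c where "c = l / sqrt (8 * pi) * exp (sqrt 2 * z / l)"
  let ?\<tau> = "norming_curve l z"
  let ?e = "\<lambda>s t. husler_reiss_V l (1/s) (1/t) - s"
  obtain s0 where mono: "strict_mono_on {s0..} ?\<tau>"
    using norming_curve_strict_mono by blast
  have \<tau>_pos: "\<forall>\<^sub>F s in at_top. ?\<tau> s > 0"
    using eventually_gt_at_top[of 0] eventually_norming_curve_factor_pos[of z]
    by eventually_elim (rule norming_curve_pos)
  have top: "filterlim (\<lambda>v::real. v + sqrt v) at_top at_top" by real_asymp
  have \<tau>_pos': "\<forall>\<^sub>F s in at_top. ?\<tau> (s + sqrt s) > 0"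
    by (rule eventually_compose_filterlim[OF \<tau>_pos top])
  have scale: "exp v * \<P>(\<omega> in M. X \<omega> > v \<and> Y \<omega> > t) = exp (- ?e v t)" if "v > 0" "t > 0" for v t
    using that by (simp add: joint exp_diff exp_minus field_simps)
  have lim: "1 - limit_G l z = exp (- c)" by (simp add: limit_G_def c_def)
  show ?thesis unfolding lim
  proof (rule tendsto_sandwich)
    show "\<forall>\<^sub>F v in at_top. exp (- ?e v (?\<tau> (v + sqrt v))) - exp (- sqrt v)
        \<le> exp v * \<P>(\<omega> in M. X \<omega> > v \<and> Y \<omega> \<ge> ?\<tau> (X \<omega>))"
      using eventually_gt_at_top[of 0] eventually_ge_at_top[of s0] \<tau>_pos'
    proof eventually_elim
      case (elim v)
      have "v + sqrt v > 0" using elim(1) by (intro add_pos_nonneg) auto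
      hence "exp v * \<P>(\<omega> in M. X \<omega> > v + sqrt v) = exp (- sqrt v)"
        by (simp add: X_tail exp_add[symmetric])
      moreover have "exp v * (\<P>(\<omega> in M. X \<omega> > v \<and> Y \<omega> > ?\<tau> (v + sqrt v)) - \<P>(\<omega> in M. X \<omega> > v + sqrt v))
          \<le> exp v * \<P>(\<omega> in M. X \<omega> > v \<and> Y \<omega> \<ge> ?\<tau> (X \<omega>))"
        using elim by (intro mult_left_mono joint_tail_sandwich(1)[OF _ _ _ mono]) auto
      ultimately show ?case using elim by (simp add: right_diff_distrib scale)
    qed
    show "\<forall>\<^sub>F v in at_top. exp v * \<P>(\<omega> in M. X \<omega> > v \<and> Y \<omega> \<ge> ?\<tau> (X \<omega>)) \<le> exp (- ?e v (?\<tau> v))"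
      using eventually_gt_at_top[of 0] eventually_ge_at_top[of s0] \<tau>_pos
    proof eventually_elim
      case (elim v)
      have "exp v * \<P>(\<omega> in M. X \<omega> > v \<and> Y \<omega> \<ge> ?\<tau> (X \<omega>))
          \<le> exp v * \<P>(\<omega> in M. X \<omega> > v \<and> Y \<omega> > ?\<tau> v)"
        using elim by (intro mult_left_mono joint_tail_sandwich(2)[OF _ _ _ mono, of _ _ v v]) auto
      also have "\<dots> = exp (- ?e v (?\<tau> v))" using elim by (intro scale)
      finally show ?case .
    qed
    have "((\<lambda>v. ?e v (?\<tau> v)) \<longlongrightarrow> c) at_top"
      unfolding c_def using assms(3) by (rule husler_reiss_V_excess_norming_curve) (auto intro: filterlim_ident)
    thus "((\<lambda>v. exp (- ?e v (?\<tau> v))) \<longlongrightarrow> exp (- c)) at_top"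
      by (intro tendsto_intros)
    have "((\<lambda>v. ?e v (?\<tau> (v + sqrt v))) \<longlongrightarrow> c) at_top"
      unfolding c_def using assms(3) top
      by (rule husler_reiss_V_excess_norming_curve) real_asymp
    moreover have "((\<lambda>v::real. exp (- sqrt v)) \<longlongrightarrow> 0) at_top" by real_asymp
    ultimately have "((\<lambda>v. exp (- ?e v (?\<tau> (v + sqrt v))) - exp (- sqrt v)) \<longlongrightarrow> exp (- c) - 0) at_top"
      by (intro tendsto_intros)
    thus "((\<lambda>v. exp (- ?e v (?\<tau> (v + sqrt v))) - exp (- sqrt v)) \<longlongrightarrow> exp (- c)) at_top" by simp
  qed
qed

theorem proposition2:
  fixes M :: "'a measure" and X Y :: "'a \<Rightarrow> real" and l :: real
    and a b :: "real \<Rightarrow> real" and x z :: real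
  assumes "prob_space M"
    and "X \<in> borel_measurable M" and "Y \<in> borel_measurable M"
    and "AE \<omega> in M. X \<omega> > 0" and "AE \<omega> in M. Y \<omega> > 0"
    and "l > 0"
    and "\<And>s t. s > 0 \<Longrightarrow> t > 0 \<Longrightarrow>
           \<P>(\<omega> in M. X \<omega> > s \<and> Y \<omega> > t) = exp (- husler_reiss_V l (1 / s) (1 / t))"
    and "\<forall>\<^sub>F s in at_top. a s = norming_a l s"
    and "\<forall>\<^sub>F s in at_top. b s = norming_b l s"
    and "x > 0"
  shows "((\<lambda>u. \<P>(\<omega> in M. X \<omega> - u > x \<and> (Y \<omega> - a (X \<omega>)) / b (X \<omega>) < z \<bar> X \<omega> > u))
           \<longlongrightarrow> exp (- x) * limit_G l z) at_top"
proof -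
  interpret prob_space M by fact
  note [measurable] = assms(2,3)
  let ?\<tau> = "norming_curve l z"
  have X_tail: "\<P>(\<omega> in M. X \<omega> > s) = exp (- s)" if "s > 0" for s
    using exponential_tail_from_joint_tail[OF assms(2,3,5,6,7) that] .
  have shift: "filterlim (\<lambda>u. u + x) at_top at_top"
    by real_asymp
  have "((\<lambda>u. exp (- x) * (1 - exp (u + x) * \<P>(\<omega> in M. X \<omega> > u + x \<and> Y \<omega> \<ge> ?\<tau> (X \<omega>))))
      \<longlongrightarrow> exp (- x) * (1 - (1 - limit_G l z))) at_top"
    by (intro tendsto_intros
        filterlim_compose[OF scaled_tail_above_norming_curve[OF assms(2,3,6) X_tail assms(7)] shift])
  hence "((\<lambda>u. exp (- x) * (1 - exp (u + x) * \<P>(\<omega> in M. X \<omega> > u + x \<and> Y \<omega> \<ge> ?\<tau> (X \<omega>))))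
      \<longlongrightarrow> exp (- x) * limit_G l z) at_top" by simp
  thus ?thesis
  proof (rule Lim_transform_eventually)
    (* Every value of X in the conditioning event lies beyond u0, so there a and b may be replaced
       by their formulas; this is also what makes the events measurable. *)
    have "\<forall>\<^sub>F u in at_top. u > 1 \<and> a u = norming_a l u \<and> b u = norming_b l u"
      using eventually_gt_at_top[of 1] assms(8,9) by eventually_elim auto
    then obtain u0 where u0: "\<And>u. u \<ge> u0 \<Longrightarrow> u > 1 \<and> a u = norming_a l u \<and> b u = norming_b l u"
      by (auto simp: eventually_at_top_linorder)
    show "\<forall>\<^sub>F u in at_top.
        exp (- x) * (1 - exp (u + x) * \<P>(\<omega> in M. X \<omega> > u + x \<and> Y \<omega> \<ge> ?\<tau> (X \<omega>)))
        = \<P>(\<omega> in M. X \<omega> - u > x \<and> (Y \<omega> - a (X \<omega>)) / b (X \<omega>) < z \<bar> X \<omega> > u)"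
      using eventually_ge_at_top[of u0]
    proof eventually_elim
      case (elim u)
      have "u > 0" using u0[OF elim] by simp
      have curve: "(Y \<omega> - a (X \<omega>)) / b (X \<omega>) < z \<longleftrightarrow> \<not> Y \<omega> \<ge> ?\<tau> (X \<omega>)" if "X \<omega> > u" for \<omega>
      proof -
        have X: "X \<omega> > 1" "a (X \<omega>) = norming_a l (X \<omega>)" "b (X \<omega>) = norming_b l (X \<omega>)"
          using u0[of "X \<omega>"] that elim by auto
        hence "b (X \<omega>) > 0" by (simp add: norming_b_def norming_a_def)
        thus ?thesis unfolding norming_curve_def X(2,3)[symmetric]
          by (auto simp: pos_divide_less_eq mult.commute)
      qed
      have "{\<omega>\<in>space M. (X \<omega> - u > x \<and> (Y \<omega> - a (X \<omega>)) / b (X \<omega>) < z) \<and> X \<omega> > u}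
          = {\<omega>\<in>space M. X \<omega> > u + x} - {\<omega>\<in>space M. X \<omega> > u + x \<and> Y \<omega> \<ge> ?\<tau> (X \<omega>)}"
        using curve \<open>x > 0\<close> by fastforce
      moreover have "prob ({\<omega>\<in>space M. X \<omega> > u + x} - {\<omega>\<in>space M. X \<omega> > u + x \<and> Y \<omega> \<ge> ?\<tau> (X \<omega>)})
          = \<P>(\<omega> in M. X \<omega> > u + x) - \<P>(\<omega> in M. X \<omega> > u + x \<and> Y \<omega> \<ge> ?\<tau> (X \<omega>))"
        by (rule finite_measure_Diff) auto
      ultimately have "\<P>(\<omega> in M. (X \<omega> - u > x \<and> (Y \<omega> - a (X \<omega>)) / b (X \<omega>) < z) \<and> X \<omega> > u)
          = \<P>(\<omega> in M. X \<omega> > u + x) - \<P>(\<omega> in M. X \<omega> > u + x \<and> Y \<omega> \<ge> ?\<tau> (X \<omega>))"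
        by metis
      moreover have "exp (- x) * (1 - exp (u + x) * B) = (exp (- (u + x)) - B) / exp (- u)" for B
        by (simp add: exp_minus exp_add exp_diff field_simps)
      ultimately show ?case
        using \<open>u > 0\<close> \<open>x > 0\<close> by (simp only: cond_prob_def X_tail add_pos_pos)
    qed
  qed
qed

end
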